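(* Let $f_0,F,S,L,g$ satisfy the standing assumptions listed in the context; in particular, for all $(x,\lambda,t)$ the unique solution of $\min_{u\in\mathbb{R}^m} H_o(x,u,\lambda,t)$ is $u_o^*=g(x,\lambda,t)$. Then there is a continuously differentiable real-valued function $h$ of $(x,\lambda,t)$ such that, for every $(x,\lambda,t)$ on a constrained arc, i.e. with $S(x,t)=0$ and $S^{(1)}(x,g(x,\lambda,t),t)\ge 0$, the constrained Hamiltonian minimization problem $$(u_c^*,\mu^* )=\arg\min_{\mu\ge 0}\ \min_{u}\ H_c(x,u,\lambda,\mu,t)\quad\text{s.t.}\quad S^{(1)}(x,u,t)=0$$ (that is: $\mu^*\ge 0$, $u_c^*$ minimizes $u\mapsto H_c(x,u,\lambda,\mu^*,t)$ over $\mathbb{R}^m$, and $S^{(1)}(x,u_c^*,t)=0$) has exactly one solution pair $(u_c^*,\mu^* )$, and it is given by $$u_c^*=g\bigl(x,\lambda+\mu^* S_x(x,t)^\top,t\bigr),\qquad \mu^*=h(x,\lambda,t)\ge 0 .$$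
   Context: Setting: the control-affine system $\dot x=f(x,u,t)=f_0(x,t)+F(x,t)u$ with state $x\in\mathbb{R}^n$, control $u\in\mathbb{R}^m$, time $t\in\mathbb{R}$; running cost $L(x,u,t)\in\mathbb{R}$, total cost $\int_0^T L\,dt$; scalar state constraint $S(x,t)\le 0$; costate $\lambda\in\mathbb{R}^n$; constraint multiplier $\mu\in\mathbb{R}$. Notation: $S_x=\nabla_x S\in\mathbb{R}^{1\times n}$ and $S_t=\partial S/\partial t\in\mathbb{R}$. The first total time derivative of $S$ along the dynamics is $$S^{(1)}(x,u,t)=S_x(x,t)f_0(x,t)+S_x(x,t)F(x,t)u+S_t(x,t).$$ The unconstrained and constrained Hamiltonians are $$H_o(x,u,\lambda,t)=L(x,u,t)+\lambda^\top[f_0(x,t)+F(x,t)u],$$ $$H_c(x,u,\lambda,\mu,t)=L(x,u,t)+\lambda^\top[f_0(x,t)+F(x,t)u]+\mu S^{(1)}(x,u,t).$$ Standing assumptions: (i) $F$ and $S$ are twice continuously differentiable, and $f_0$ is twice (continuously) differentiable. (ii) The constraint is of first order: $S_x(x,t)F(x,t)\neq 0$ for all $x,t$. (iii) For all $(x,\lambda,t)\in\mathbb{R}^n\times\mathbb{R}^n\times\mathbb{R}$, the problem $\min_{u\in\mathbb{R}^m}H_o(x,u,\lambda,t)$ has a unique solution $u_o^*=g(x,\lambda,t)$, where $g$ is continuously differentiable, $L$ is twice continuously differentiable in $u$, and at $u=g(x,\lambda,t)$ the Legendre–Clebsch condition holds: $\nabla_u H_o=\nabla_u L(x,u,t)+\lambda^\top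 F(x,t)=0$ and $\nabla^2_{uu}H_o=\nabla^2_{uu}L(x,u,t)\succ 0$ (positive definite). *)

theory Defs
  imports "HOL-Analysis.Analysis"
begin

definition cont_diff :: "('a::real_normed_vector \<Rightarrow> 'b::real_normed_vector) \<Rightarrow> bool" where
  "cont_diff f \<longleftrightarrow>
    (\<exists>f' :: 'a \<Rightarrow> 'a \<Rightarrow>\<^sub>L 'b.
      (\<forall>z. (f has_derivative blinfun_apply (f' z)) (at z)) \<and> continuous_on UNIV f')"

definition twice_diff :: "('a::real_normed_vector \<Rightarrow> 'b::real_normed_vector) \<Rightarrow> bool" where
  "twice_diff f \<longleftrightarrow>
    (\<exists>f' :: 'a \<Rightarrow> 'a \<Rightarrow>\<^sub>L 'b.
      (\<forall>z. (f has_derivative blinfun_apply (f' z)) (at z)) \<and> (\<forall>z. f' differentiable (at z)))"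

definition twice_cont_diff :: "('a::real_normed_vector \<Rightarrow> 'b::real_normed_vector) \<Rightarrow> bool" where
  "twice_cont_diff f \<longleftrightarrow>
    (\<exists>f' :: 'a \<Rightarrow> 'a \<Rightarrow>\<^sub>L 'b.
      (\<forall>z. (f has_derivative blinfun_apply (f' z)) (at z)) \<and> cont_diff f')"

text \<open>Only meaningful where the function is differentiable, as are all uses below.\<close>

definition grad :: "('a::real_inner \<Rightarrow> real) \<Rightarrow> 'a \<Rightarrow> 'a" where
  "grad f x = (THE D. GDERIV f x :> D)"

lemma grad_eqI:
  assumes "GDERIV f x :> D"
  shows "grad f x = D"
  unfolding grad_def
proof (rule the_equality)
  show "GDERIV f x :> D" by (fact assms)
next
  fix E assume "GDERIV f x :> E"
  then have "(\<lambda>h. inner h E) = (\<lambda>h. inner h D)"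
    using assms has_derivative_unique unfolding gderiv_def by blast
  then have "\<And>h. inner h E = inner h D" by meson
  then show "E = D" using vector_eq_ldot by blast
qed

definition hessian :: "(real ^ 'm \<Rightarrow> real) \<Rightarrow> real ^ 'm \<Rightarrow> real ^ 'm ^ 'm" where
  "hessian f u = matrix (frechet_derivative (grad f) (at u))"

text \<open>Symmetry is not demanded: it is automatic for the Hessian of a twice continuously
  differentiable function, the only matrix this is applied to.\<close>

definition pos_def :: "real ^ 'm ^ 'm \<Rightarrow> bool" where
  "pos_def A \<longleftrightarrow> (\<forall>v. v \<noteq> 0 \<longrightarrow> v \<bullet> (A *v v) > 0)"

text \<open>The costate $\lambda$ is written \<open>l\<close>. Row vectors such as $S_x$ are represented by
  elements of \<open>real ^ 'n\<close>, so that $S_x F$ reads \<open>S_x v* F\<close>.\<close>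

definition Sx :: "(real ^ 'n \<Rightarrow> real \<Rightarrow> real) \<Rightarrow> real ^ 'n \<Rightarrow> real \<Rightarrow> real ^ 'n" where
  "Sx S x t = grad (\<lambda>y. S y t) x"

definition St :: "(real ^ 'n \<Rightarrow> real \<Rightarrow> real) \<Rightarrow> real ^ 'n \<Rightarrow> real \<Rightarrow> real" where
  "St S x t = deriv (\<lambda>s. S x s) t"

definition S1 ::
  "(real ^ 'n \<Rightarrow> real \<Rightarrow> real ^ 'n) \<Rightarrow> (real ^ 'n \<Rightarrow> real \<Rightarrow> real ^ 'm ^ 'n) \<Rightarrow>
   (real ^ 'n \<Rightarrow> real \<Rightarrow> real) \<Rightarrow> real ^ 'n \<Rightarrow> real ^ 'm \<Rightarrow> real \<Rightarrow> real" where
  "S1 f0 F S x u t = Sx S x t \<bullet> f0 x t + (Sx S x t v* F x t) \<bullet> u + St S x t"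

definition Ho ::
  "(real ^ 'n \<Rightarrow> real \<Rightarrow> real ^ 'n) \<Rightarrow> (real ^ 'n \<Rightarrow> real \<Rightarrow> real ^ 'm ^ 'n) \<Rightarrow>
   (real ^ 'n \<Rightarrow> real ^ 'm \<Rightarrow> real \<Rightarrow> real) \<Rightarrow>
   real ^ 'n \<Rightarrow> real ^ 'm \<Rightarrow> real ^ 'n \<Rightarrow> real \<Rightarrow> real" where
  "Ho f0 F L x u l t = L x u t + l \<bullet> (f0 x t + F x t *v u)"

definition Hc ::
  "(real ^ 'n \<Rightarrow> real \<Rightarrow> real ^ 'n) \<Rightarrow> (real ^ 'n \<Rightarrow> real \<Rightarrow> real ^ 'm ^ 'n) \<Rightarrow>
   (real ^ 'n \<Rightarrow> real \<Rightarrow> real) \<Rightarrow> (real ^ 'n \<Rightarrow> real ^ 'm \<Rightarrow> real \<Rightarrow> real) \<Rightarrow>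
   real ^ 'n \<Rightarrow> real ^ 'm \<Rightarrow> real ^ 'n \<Rightarrow> real \<Rightarrow> real \<Rightarrow> real" where
  "Hc f0 F S L x u l \<mu> t = L x u t + l \<bullet> (f0 x t + F x t *v u) + \<mu> * S1 f0 F S x u t"

text \<open>The constraint $S^{(1)} = 0$ is imposed on the solution pair; for fixed \<open>\<mu>\<close> the
  minimization over \<open>u\<close> is unconstrained.\<close>

definition solves_constrained ::
  "(real ^ 'n \<Rightarrow> real \<Rightarrow> real ^ 'n) \<Rightarrow> (real ^ 'n \<Rightarrow> real \<Rightarrow> real ^ 'm ^ 'n) \<Rightarrow>
   (real ^ 'n \<Rightarrow> real \<Rightarrow> real) \<Rightarrow> (real ^ 'n \<Rightarrow> real ^ 'm \<Rightarrow> real \<Rightarrow> real) \<Rightarrow>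
   real ^ 'n \<Rightarrow> real ^ 'n \<Rightarrow> real \<Rightarrow> real ^ 'm \<Rightarrow> real \<Rightarrow> bool" where
  "solves_constrained f0 F S L x l t u \<mu> \<longleftrightarrow>
    \<mu> \<ge> 0 \<and> is_arg_min (\<lambda>v. Hc f0 F S L x v l \<mu> t) (\<lambda>v. True) u \<and> S1 f0 F S x u t = 0"

end

theory Submission
  imports Defs
begin

text \<open>The multiplier enters the constrained Hamiltonian only through the shifted costate
  \<open>l + \<mu> S\<^sub>x\<close>, so for fixed \<open>\<mu>\<close> the minimizer is \<open>g(x, l + \<mu> S\<^sub>x, t)\<close> and \<open>\<mu>\<close> has to solve the
  scalar equation \<open>\<phi>(\<mu>) = S\<^sup>(\<^sup>1\<^sup>)(x, g(x, l + \<mu> S\<^sub>x, t), t) = 0\<close>. Differentiating the stationarity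
  condition in \<open>\<mu>\<close> gives \<open>\<phi>' = - S\<^sub>x F (\<nabla>\<^sup>2L)\<^sup>-\<^sup>1 (S\<^sub>x F)\<^sup>T < 0\<close>. Since the minimum is attained for every
  costate, a comparison of minimizers shows that \<open>\<phi>\<close> takes every real value. Hence the root is
  unique and defined for all \<open>(x, l, t)\<close>, it is continuously differentiable by the implicit function
  theorem, and it is nonnegative exactly when \<open>\<phi>(0) \<ge> 0\<close>.\<close>

section \<open>Continuously differentiable functions\<close>

lemma cont_diff_imp_continuous:
  assumes "cont_diff f"
  shows "continuous_on UNIV f"
proof -
  obtain f' where "\<And>z. (f has_derivative blinfun_apply (f' z)) (at z)"
    using assms unfolding cont_diff_def by blast
  then show ?thesis
    by (intro continuous_at_imp_continuous_on ballI has_derivative_continuous)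
qed

lemma cont_diff_bounded_linear:
  assumes "bounded_linear f"
  shows "cont_diff f"
  unfolding cont_diff_def
proof (intro exI[of _ "\<lambda>_. Blinfun f"] conjI allI)
  show "(f has_derivative blinfun_apply (Blinfun f)) (at z)" for z
    using assms by (simp add: bounded_linear_Blinfun_apply bounded_linear_imp_has_derivative)
qed simp

lemma cont_diff_const: "cont_diff (\<lambda>_. c)"
  unfolding cont_diff_def by (intro exI[of _ "\<lambda>_. 0"]) (auto simp: zero_blinfun.rep_eq)

lemma cont_diff_compose:
  assumes "cont_diff f" "cont_diff g"
  shows "cont_diff (\<lambda>x. f (g x))"
proof -
  obtain f' g' where f': "\<And>z. (f has_derivative blinfun_apply (f' z)) (at z)" "continuous_on UNIV f'"
    and g': "\<And>z. (g has_derivative blinfun_apply (g' z)) (at z)" "continuous_on UNIV g'"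
    using assms unfolding cont_diff_def by blast
  show ?thesis unfolding cont_diff_def
  proof (intro exI[of _ "\<lambda>z. f' (g z) o\<^sub>L g' z"] conjI allI)
    show "((\<lambda>x. f (g x)) has_derivative blinfun_apply (f' (g z) o\<^sub>L g' z)) (at z)" for z
      using has_derivative_compose[OF g'(1) f'(1)] by (simp add: blinfun_compose.rep_eq o_def)
    show "continuous_on UNIV (\<lambda>z. f' (g z) o\<^sub>L g' z)"
      by (intro continuous_intros g' continuous_on_compose2[OF f'(2) cont_diff_imp_continuous[OF assms(2)]]) auto
  qed
qed

lemma cont_diff_add:
  assumes "cont_diff f" "cont_diff g"
  shows "cont_diff (\<lambda>x. f x + g x)"
proof -
  obtain f' g' where "\<And>z. (f has_derivative blinfun_apply (f' z)) (at z)" "continuous_on UNIV f'"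
    and "\<And>z. (g has_derivative blinfun_apply (g' z)) (at z)" "continuous_on UNIV g'"
    using assms unfolding cont_diff_def by blast
  then show ?thesis unfolding cont_diff_def
    by (intro exI[of _ "\<lambda>z. f' z + g' z"])
      (auto intro!: continuous_intros has_derivative_add simp: plus_blinfun.rep_eq)
qed

text \<open>The product rule in a generality that covers every product in the multiplier equation:
  inner products, scalings and matrix-vector products.\<close>

lemma cont_diff_bilinear:
  assumes B: "bounded_bilinear B" and "cont_diff f" "cont_diff g"
  shows "cont_diff (\<lambda>x. B (f x) (g x))"
proof -
  interpret B: bounded_bilinear B by (fact B)
  obtain f' g' where f': "\<And>z. (f has_derivative blinfun_apply (f' z)) (at z)" "continuous_on UNIV f'"
    and g': "\<And>z. (g has_derivative blinfun_apply (g' z)) (at z)" "continuous_on UNIV g'"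
    using assms unfolding cont_diff_def by blast
  show ?thesis unfolding cont_diff_def
  proof (intro exI[of _ "\<lambda>z. (B.prod_right (f z) o\<^sub>L g' z) + (B.prod_left (g z) o\<^sub>L f' z)"] conjI allI)
    fix z
    show "((\<lambda>x. B (f x) (g x)) has_derivative
        blinfun_apply ((B.prod_right (f z) o\<^sub>L g' z) + (B.prod_left (g z) o\<^sub>L f' z))) (at z)"
      using B.FDERIV[OF f'(1)[of z] g'(1)[of z]]
      by (simp add: plus_blinfun.rep_eq B.prod_right.rep_eq B.prod_left.rep_eq)
  next
    show "continuous_on UNIV (\<lambda>z. (B.prod_right (f z) o\<^sub>L g' z) + (B.prod_left (g z) o\<^sub>L f' z))"
      by (intro continuous_intros f' g' bounded_linear.continuous_on[OF B.bounded_linear_prod_right]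
          bounded_linear.continuous_on[OF B.bounded_linear_prod_left]
          cont_diff_imp_continuous assms)
  qed
qed

lemma cont_diff_linear_compose:
  assumes "bounded_linear T" "cont_diff f"
  shows "cont_diff (\<lambda>x. T (f x))"
  using assms(2) by (rule cont_diff_compose[OF cont_diff_bounded_linear[OF assms(1)]])

lemma cont_diff_Pair:
  fixes f :: "'a::real_normed_vector \<Rightarrow> 'b::real_normed_vector"
    and g :: "'a \<Rightarrow> 'c::real_normed_vector"
  assumes "cont_diff f" "cont_diff g"
  shows "cont_diff (\<lambda>x. (f x, g x))"
proof -
  have "bounded_linear (\<lambda>y::'b. (y, 0::'c))" "bounded_linear (\<lambda>y::'c. (0::'b, y))"
    by (intro bounded_linear_intros)+
  \<comment> \<open>Split into the two linear embeddings, a pair needs only the chain rule and the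
    sum rule.\<close>
  then have "cont_diff (\<lambda>x. (f x, 0) + (0, g x))"
    using assms by (intro cont_diff_add) (rule cont_diff_linear_compose, assumption+)+
  then show ?thesis by simp
qed

section \<open>Twice differentiable functions and their gradients\<close>

lemma twice_diff_imp_cont_diff:
  assumes "twice_diff f"
  shows "cont_diff f"
proof -
  obtain f' where f': "\<And>z. (f has_derivative blinfun_apply (f' z)) (at z)" "\<And>z. f' differentiable (at z)"
    using assms unfolding twice_diff_def by blast
  from f'(2) have "continuous_on UNIV f'"
    by (intro continuous_at_imp_continuous_on ballI differentiable_imp_continuous_within)
  with f'(1) show ?thesis unfolding cont_diff_def by blast
qed

lemma twice_cont_diff_imp_cont_diff:
  assumes "twice_cont_diff f"
  shows "cont_diff f"
proof -
  obtain f' where f': "\<And>z. (f has_derivative blinfun_apply (f' z)) (at z)" "cont_diff f'"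
    using assms unfolding twice_cont_diff_def by blast
  from f'(1) cont_diff_imp_continuous[OF f'(2)] show ?thesis unfolding cont_diff_def by blast
qed

text \<open>Riesz representation in coordinates: the vector with entries \<open>f' x i\<close>
  represents the derivative, and uniqueness identifies it with \<open>grad f x\<close>.\<close>

lemma cont_diff_GDERIV:
  fixes f :: "'a::euclidean_space \<Rightarrow> real"
  assumes "cont_diff f"
  shows "GDERIV f x :> grad f x"
proof -
  obtain f' where f': "(f has_derivative blinfun_apply (f' x)) (at x)"
    using assms unfolding cont_diff_def by blast
  have "blinfun_apply (f' x) = (\<lambda>h. h \<bullet> (\<Sum>i\<in>Basis. f' x i *\<^sub>R i))"
  proof
    fix h
    have "f' x h = f' x (\<Sum>i\<in>Basis. (h \<bullet> i) *\<^sub>R i)" by (simp add: euclidean_representation)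
    also have "\<dots> = h \<bullet> (\<Sum>i\<in>Basis. f' x i *\<^sub>R i)"
      by (simp add: blinfun.sum_right blinfun.scaleR_right inner_sum_right mult.commute)
    finally show "f' x h = h \<bullet> (\<Sum>i\<in>Basis. f' x i *\<^sub>R i)" .
  qed
  then have "GDERIV f x :> (\<Sum>i\<in>Basis. f' x i *\<^sub>R i)"
    using f' by (simp add: gderiv_def)
  then show ?thesis using grad_eqI by metis
qed

text \<open>The Riesz identification of functionals with vectors is one fixed bounded linear map, so
  the gradient inherits the smoothness of the derivative.\<close>

lemma cont_diff_grad:
  fixes f :: "'a::euclidean_space \<Rightarrow> real"
  assumes "twice_cont_diff f"
  shows "cont_diff (grad f)"
proof -
  obtain f' where f': "\<And>z. (f has_derivative blinfun_apply (f' z)) (at z)" "cont_diff f'"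
    using assms unfolding twice_cont_diff_def by blast
  have "grad f z = (\<Sum>i\<in>Basis. f' z i *\<^sub>R i)" for z
  proof -
    have "blinfun_apply (f' z) = (\<lambda>h. h \<bullet> grad f z)"
      using has_derivative_unique[OF f'(1)] cont_diff_GDERIV[OF twice_cont_diff_imp_cont_diff[OF assms]]
      unfolding gderiv_def by blast
    then show ?thesis by (simp add: inner_commute[of _ "grad f z"] euclidean_representation)
  qed
  then have eq: "grad f = (\<lambda>z. \<Sum>i\<in>Basis. f' z i *\<^sub>R i)" by blast
  have "bounded_linear (\<lambda>A. \<Sum>i\<in>(Basis::'a set). blinfun_apply A i *\<^sub>R i)"
    by (intro bounded_linear_sum bounded_linear_compose[OF bounded_linear_scaleR_left]
        blinfun.bounded_linear_left)
  from cont_diff_linear_compose[OF this f'(2)] show ?thesis unfolding eq .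
qed

section \<open>An implicit function theorem for monotone equations\<close>

text \<open>Strict decrease and surjectivity in \<open>s\<close> give one global root for each
  \<open>p\<close>. Its smoothness follows by inverting
  \<open>(p, s) \<mapsto> (p, \<phi> (p, s))\<close>, whose derivative is invertible because the
  slope in \<open>s\<close> is nonzero.\<close>

lemma implicit_function_decreasing:
  fixes \<phi> :: "'a::real_normed_vector \<times> real \<Rightarrow> real"
  assumes \<phi>: "cont_diff \<phi>"
    and neg: "\<And>p s D. ((\<lambda>s. \<phi> (p, s)) has_real_derivative D) (at s) \<Longrightarrow> D < 0"
    and surj: "\<And>p c. \<exists>s. \<phi> (p, s) = c"
  shows "\<exists>h. cont_diff h \<and> (\<forall>p s. (\<phi> (p, s) < 0 \<longleftrightarrow> h p < s) \<and> (\<phi> (p, s) = 0 \<longleftrightarrow> s = h p))"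
proof -
  obtain \<phi>' where \<phi>': "\<And>z. (\<phi> has_derivative blinfun_apply (\<phi>' z)) (at z)" "continuous_on UNIV \<phi>'"
    using \<phi> unfolding cont_diff_def by blast
  have slope: "((\<lambda>s. \<phi> (p, s)) has_real_derivative \<phi>' (p, s) (0, 1)) (at s)" for p s
  proof -
    have "((\<lambda>s. \<phi> (p, s)) has_derivative (\<lambda>r. \<phi>' (p, s) (0, r))) (at s)"
      by (rule has_derivative_compose[OF _ \<phi>'(1)]) (auto intro!: derivative_eq_intros)
    moreover have "(\<lambda>r. \<phi>' (p, s) (0, r)) = (\<lambda>r. \<phi>' (p, s) (0, 1) * r)"
    proof
      show "\<phi>' (p, s) (0, r) = \<phi>' (p, s) (0, 1) * r" for r
        using blinfun.scaleR_right[of "\<phi>' (p, s)" r "(0, 1)"] by simp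
    qed
    ultimately show ?thesis by (simp add: has_field_derivative_def)
  qed
  have slope_neg: "\<phi>' (p, s) (0, 1) < 0" for p s using neg slope by blast
  have mono: "\<phi> (p, r) < \<phi> (p, s)" if "s < r" for p r s
    using DERIV_neg_imp_decreasing[OF that] slope slope_neg by meson
  have less_iff: "\<phi> (p, r) < \<phi> (p, s) \<longleftrightarrow> s < r" for p r s
    using mono by (metis linorder_neqE_linordered_idom order_less_asym)
  \<comment> \<open>All levels \<open>c\<close> are inverted, not only 0: differentiating the
    inverse \<open>\<Psi>\<close> of \<open>\<Phi>\<close> requires it on an open set around
    \<open>(p, 0)\<close>.\<close>
  define \<psi> where "\<psi> z = (SOME s. \<phi> (fst z, s) = snd z)" for z
  have \<psi>: "\<phi> (p, \<psi> (p, c)) = c" for p c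
    unfolding \<psi>_def using someI_ex[OF surj[of p c]] by simp
  have less_\<psi>: "s < \<psi> (p, c) \<longleftrightarrow> c < \<phi> (p, s)" and \<psi>_less: "\<psi> (p, c) < s \<longleftrightarrow> \<phi> (p, s) < c"
    for p c s using less_iff \<psi> by metis+
  define \<Phi> where "\<Phi> z = (fst z, \<phi> z)" for z
  define \<Psi> where "\<Psi> z = (fst z, \<psi> z)" for z
  have \<phi>_cont: "((\<lambda>z. \<phi> (fst z, s)) \<longlongrightarrow> \<phi> (p, s)) (at (p, c))" for p s and c :: real
  proof -
    have "isCont \<phi> (p, s)" using \<phi>'(1) has_derivative_continuous by blast
    moreover have "((\<lambda>z. (fst z, s)) \<longlongrightarrow> (p, s)) (at (p, c))" by (auto intro!: tendsto_eq_intros)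
    ultimately show ?thesis using isCont_tendsto_compose by fast
  qed
  \<comment> \<open>For fixed \<open>s\<close>, each of \<open>s < \<psi> z\<close> and
    \<open>\<psi> z < s\<close> is a strict inequality between functions continuous in
    \<open>z\<close>, hence persists near \<open>(p, c)\<close>.\<close>
  have \<psi>_cont: "isCont \<psi> (p, c)" for p c
    unfolding isCont_def
  proof (rule order_tendstoI)
    have snd_cont: "(snd \<longlongrightarrow> c) (at (p, c))" by (auto intro!: tendsto_eq_intros)
    fix s
    { assume "s < \<psi> (p, c)"
      then have "0 < \<phi> (p, s) - c" by (simp add: less_\<psi>)
      then have "\<forall>\<^sub>F z in at (p, c). 0 < \<phi> (fst z, s) - snd z"
        by (rule order_tendstoD(1)[rotated]) (intro tendsto_diff \<phi>_cont snd_cont)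
      then show "\<forall>\<^sub>F z in at (p, c). s < \<psi> z"
        by eventually_elim (use less_\<psi> in force) }
    { assume "\<psi> (p, c) < s"
      then have "\<phi> (p, s) - c < 0" by (simp add: \<psi>_less)
      then have "\<forall>\<^sub>F z in at (p, c). \<phi> (fst z, s) - snd z < 0"
        by (rule order_tendstoD(2)[rotated]) (intro tendsto_diff \<phi>_cont snd_cont)
      then show "\<forall>\<^sub>F z in at (p, c). \<psi> z < s"
        by eventually_elim (use \<psi>_less in force) }
  qed
  define h where "h p = \<psi> (p, 0)" for p
  \<comment> \<open>Differentiating \<open>\<phi> (p, h p) = 0\<close> yields this formula;
    composing with \<open>v \<mapsto> (v, 0)\<close> takes the partial derivative in
    \<open>p\<close>.\<close>
  define h' where "h' p = (- inverse (\<phi>' (p, h p) (0, 1))) *\<^sub>R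
    (\<phi>' (p, h p) o\<^sub>L Blinfun (\<lambda>v. (v, 0)))" for p
  have lin: "bounded_linear (\<lambda>v::'a. (v, 0::real))" by (intro bounded_linear_intros)
  have "(h has_derivative blinfun_apply (h' p)) (at p)" for p
  proof -
    define d where "d = \<phi>' (p, h p) (0, 1)"
    have d: "d \<noteq> 0" using slope_neg[of p "h p"] by (simp add: d_def)
    have split: "\<phi>' (p, h p) (v, r) = \<phi>' (p, h p) (v, 0) + d * r" for v r
      using blinfun.add_right[of "\<phi>' (p, h p)" "(v, 0)" "(0, r)"]
        blinfun.scaleR_right[of "\<phi>' (p, h p)" r "(0, 1)"]
      by (simp add: d_def)
    \<comment> \<open>The derivative of \<open>\<Phi>\<close> is block triangular,
      \<open>(v, r) \<mapsto> (v, \<phi>' (p, h p) (v, 0) + d * r)\<close>; its inverse comes from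
      solving the second component for \<open>r\<close>.\<close>
    define \<Psi>' where "\<Psi>' z = (fst z, (snd z - \<phi>' (p, h p) (fst z, 0)) / d)" for z
    have "(\<Psi> has_derivative \<Psi>') (at (p, 0))"
    proof (rule has_derivative_inverse_basic[where f = \<Phi> and T = UNIV])
      show "(\<Phi> has_derivative (\<lambda>z. (fst z, \<phi>' (p, h p) z))) (at (\<Psi> (p, 0)))"
        unfolding \<Phi>_def \<Psi>_def h_def fst_conv by (intro derivative_intros \<phi>')
      show "bounded_linear \<Psi>'" unfolding \<Psi>'_def divide_inverse
        by (intro bounded_linear_Pair bounded_linear_fst bounded_linear_snd bounded_linear_sub
            bounded_linear_mult_left[THEN bounded_linear_compose]
            blinfun.bounded_linear_right[THEN bounded_linear_compose] bounded_linear_zero)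
      show "\<Psi>' \<circ> (\<lambda>z. (fst z, \<phi>' (p, h p) z)) = id"
      proof
        show "(\<Psi>' \<circ> (\<lambda>z. (fst z, \<phi>' (p, h p) z))) z = id z" for z
          using d split[of "fst z" "snd z"] by (simp add: \<Psi>'_def)
      qed
      show "isCont \<Psi> (p, 0)" unfolding \<Psi>_def by (intro continuous_intros \<psi>_cont)
    qed (auto simp: \<Phi>_def \<Psi>_def \<psi>)
    then have "((\<lambda>q. snd (\<Psi> (q, 0))) has_derivative (\<lambda>v. snd (\<Psi>' (v, 0)))) (at p)"
      by (intro has_derivative_snd has_derivative_compose[where f = "\<lambda>q. (q, 0)" and g = \<Psi>]
          bounded_linear_imp_has_derivative lin)
    moreover have "snd (\<Psi>' (v, 0)) = blinfun_apply (h' p) v" for v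
      by (simp add: \<Psi>'_def h'_def d_def scaleR_blinfun.rep_eq uminus_blinfun.rep_eq
          bounded_linear_Blinfun_apply[OF lin] divide_inverse)
    ultimately show ?thesis by (simp add: \<Psi>_def h_def[abs_def])
  qed
  moreover have "continuous_on UNIV h'"
  proof -
    have "continuous_on UNIV h"
      by (rule continuous_at_imp_continuous_on) (use calculation has_derivative_continuous in blast)
    then have "continuous_on UNIV (\<lambda>p. \<phi>' (p, h p))"
      by (intro continuous_on_compose2[OF \<phi>'(2)] continuous_intros) auto
    moreover have "\<phi>' (p, h p) (0, 1) \<noteq> 0" for p using slope_neg[of p "h p"] by simp
    ultimately show ?thesis unfolding h'_def[abs_def] by (intro continuous_intros) auto
  qed
  ultimately have "cont_diff h" unfolding cont_diff_def by blast
  moreover have "\<phi> (p, s) < 0 \<longleftrightarrow> h p < s" "\<phi> (p, s) = 0 \<longleftrightarrow> s = h p" for p s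
    using less_\<psi>[of s p 0] \<psi>_less[of p 0 s] \<psi>[of p 0] unfolding h_def
    by (auto simp: not_less_iff_gr_or_eq)
  ultimately show ?thesis by blast
qed

section \<open>The multiplier equation\<close>

text \<open>Differentiating the stationarity condition gives \<open>G' \<gamma>' = - a\<close>. So
  \<open>\<gamma>'\<close> is nonzero, and
  \<open>a \<bullet> \<gamma>' = - (\<gamma>' \<bullet> G' \<gamma>')\<close> is negative by
  positivity of \<open>G'\<close>.\<close>

lemma stationary_path_slope_neg:
  fixes G :: "'a::real_inner \<Rightarrow> 'a"
  assumes stationary: "\<And>r. G (\<gamma> r) + (b + r *\<^sub>R a) = 0" and "a \<noteq> 0"
    and G: "(G has_derivative G') (at (\<gamma> s))"
    and pos: "\<And>v. v \<noteq> 0 \<Longrightarrow> v \<bullet> G' v > 0"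
    and \<gamma>: "(\<gamma> has_vector_derivative \<gamma>') (at s)"
  shows "a \<bullet> \<gamma>' < 0"
proof -
  have "((\<lambda>r. G (\<gamma> r)) has_derivative (\<lambda>r. G' (r *\<^sub>R \<gamma>'))) (at s)"
    using has_derivative_compose[OF \<gamma>[unfolded has_vector_derivative_def] G] .
  moreover have "(\<lambda>r. G (\<gamma> r)) = (\<lambda>r. - (b + r *\<^sub>R a))"
    using stationary unfolding eq_neg_iff_add_eq_0[symmetric] by blast
  moreover have "((\<lambda>r. - (b + r *\<^sub>R a)) has_derivative (\<lambda>r. - (r *\<^sub>R a))) (at s)"
    by (auto intro!: derivative_eq_intros)
  ultimately have "(\<lambda>r. G' (r *\<^sub>R \<gamma>')) = (\<lambda>r. - (r *\<^sub>R a))"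
    using has_derivative_unique by metis
  then have eq: "G' \<gamma>' = - a" by (metis scaleR_one)
  then have "\<gamma>' \<noteq> 0"
    using \<open>a \<noteq> 0\<close> G has_derivative_bounded_linear linear_simps(3) by fastforce
  from pos[OF this] show ?thesis by (simp add: eq inner_commute)
qed

text \<open>Weak duality: comparing \<open>\<gamma> s\<close> with one fixed \<open>u\<close> on the level set \<open>a \<bullet> u = c \<mp> 1\<close> at a
  multiplier \<open>s\<close> of large modulus pushes \<open>a \<bullet> \<gamma> s\<close> past \<open>c\<close>.\<close>

lemma minimizer_path_level_crossed:
  fixes \<gamma> :: "real \<Rightarrow> 'a::real_inner"
  assumes min: "\<And>s u. q (\<gamma> s) + s * (a \<bullet> \<gamma> s) \<le> q u + s * (a \<bullet> u)" and "a \<noteq> 0"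
    and cont: "continuous_on UNIV \<gamma>"
  shows "\<exists>s. a \<bullet> \<gamma> s = c"
proof -
  \<comment> \<open>The comparison point is the multiple of \<open>a\<close> on the hyperplane
    \<open>a \<bullet> u = d\<close>. Minimality at multiplier 0 bounds
    \<open>q (\<gamma> s)\<close> below by \<open>q (\<gamma> 0)\<close>, which makes the bound
    independent of \<open>s\<close>.\<close>
  have gap: "s * (a \<bullet> \<gamma> s - d) \<le> q ((d / (a \<bullet> a)) *\<^sub>R a) - q (\<gamma> 0)" for s d
    using min[of s "(d / (a \<bullet> a)) *\<^sub>R a"] min[of 0 "\<gamma> s"] \<open>a \<noteq> 0\<close> by (simp add: algebra_simps)
  obtain C where C: "\<And>s. s * (a \<bullet> \<gamma> s - (c - 1)) \<le> C" using gap by meson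
  obtain D where D: "\<And>s. s * (a \<bullet> \<gamma> s - (c + 1)) \<le> D" using gap by meson
  \<comment> \<open>The offset 1 in the level is the margin: above \<open>c\<close>, the bounded
    product would be at least \<open>\<bar>C\<bar> + 1\<close>, exceeding \<open>C\<close>.\<close>
  have "a \<bullet> \<gamma> (\<bar>C\<bar> + 1) \<le> c"
  proof (rule ccontr)
    assume "\<not> ?thesis"
    then have "(\<bar>C\<bar> + 1) * 1 \<le> (\<bar>C\<bar> + 1) * (a \<bullet> \<gamma> (\<bar>C\<bar> + 1) - (c - 1))"
      by (intro mult_left_mono) auto
    also have "\<dots> \<le> C" by (rule C)
    finally show False by simp
  qed
  moreover have "c \<le> a \<bullet> \<gamma> (- (\<bar>D\<bar> + 1))"
  proof (rule ccontr)
    assume "\<not> ?thesis"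
    then have "(\<bar>D\<bar> + 1) * 1 \<le> (\<bar>D\<bar> + 1) * (c + 1 - a \<bullet> \<gamma> (- (\<bar>D\<bar> + 1)))"
      by (intro mult_left_mono) auto
    also have "\<dots> = - (\<bar>D\<bar> + 1) * (a \<bullet> \<gamma> (- (\<bar>D\<bar> + 1)) - (c + 1))" by (simp add: algebra_simps)
    also have "\<dots> \<le> D" by (rule D)
    finally show False by simp
  qed
  moreover have "continuous_on {- (\<bar>D\<bar> + 1)..\<bar>C\<bar> + 1} (\<lambda>s. a \<bullet> \<gamma> s)"
    using cont by (intro continuous_intros) (auto intro: continuous_on_subset)
  ultimately show ?thesis using IVT2'[of "\<lambda>s. a \<bullet> \<gamma> s" "\<bar>C\<bar> + 1" c "- (\<bar>D\<bar> + 1)"] by force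
qed

section \<open>Partial derivatives of the constraint and structure of the Hamiltonians\<close>

lemma bounded_bilinear_matrix_vector_mult:
  "bounded_bilinear ((*v) :: real ^ 'n ^ 'm \<Rightarrow> real ^ 'n \<Rightarrow> real ^ 'm)"
  unfolding bilinear_conv_bounded_bilinear[symmetric] bilinear_def
  by (auto intro!: linearI simp: matrix_vector_mult_add_rdistrib matrix_vector_right_distrib
      scaleR_matrix_vector_assoc[symmetric] matrix_vector_mult_scaleR)

text \<open>Restricting the joint derivative to the two coordinate slices gives its components. This
  carries joint smoothness of \<open>S\<close> over to \<open>Sx\<close> and \<open>St\<close>,
  which are defined one variable at a time.\<close>

lemma Sx_St_grad:
  assumes "cont_diff (\<lambda>(x, t). S x t)"
  shows "Sx S x t = fst (grad (\<lambda>(x, t). S x t) (x, t))"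
    and "St S x t = snd (grad (\<lambda>(x, t). S x t) (x, t))"
proof -
  define D where "D = grad (\<lambda>(x, t). S x t) (x, t)"
  have D: "((\<lambda>(x, t). S x t) has_derivative (\<lambda>h. h \<bullet> D)) (at (x, t))"
    using cont_diff_GDERIV[OF assms, of "(x, t)"] by (simp add: gderiv_def D_def)
  have "((\<lambda>y. (\<lambda>(x, t). S x t) (y, t)) has_derivative (\<lambda>h. (h, 0) \<bullet> D)) (at x)"
    by (rule has_derivative_compose[where g = "\<lambda>(x, t). S x t" and g' = "\<lambda>h. h \<bullet> D"])
      (auto intro!: derivative_eq_intros D)
  then have "GDERIV (\<lambda>y. S y t) x :> fst D" by (simp add: gderiv_def inner_prod_def)
  then show "Sx S x t = fst D" unfolding Sx_def by (rule grad_eqI)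
  have "((\<lambda>s. (\<lambda>(x, t). S x t) (x, s)) has_derivative (\<lambda>h. (0, h) \<bullet> D)) (at t)"
    by (rule has_derivative_compose[where g = "\<lambda>(x, t). S x t" and g' = "\<lambda>h. h \<bullet> D"])
      (auto intro!: derivative_eq_intros D)
  then have "((\<lambda>s. S x s) has_real_derivative snd D) (at t)"
    by (simp add: has_field_derivative_def inner_prod_def mult_commute_abs)
  then show "St S x t = snd D" unfolding St_def by (rule DERIV_imp_deriv)
qed

lemma S1_eq: "S1 f0 F S x u t = Sx S x t \<bullet> (f0 x t + F x t *v u) + St S x t"
  unfolding S1_def by (simp add: inner_add_right dot_lmul_matrix)

text \<open>The term left over beside the costate shift is free of \<open>u\<close>, so both sides
  have the same minimizers in \<open>u\<close>.\<close>

lemma Hc_eq: "Hc f0 F S L x u l \<mu> t = Ho f0 F L x u (l + \<mu> *\<^sub>R Sx S x t) t + \<mu> * St S x t"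
  unfolding Hc_def Ho_def S1_eq by (simp add: algebra_simps inner_add_left)

text \<open>Apart from \<open>L\<close>, the Hamiltonian is affine in \<open>u\<close>; the costate
  therefore changes the gradient by a constant and leaves the Hessian alone.\<close>

lemma grad_Ho:
  assumes "twice_cont_diff (\<lambda>u. L x u t)"
  shows "grad (\<lambda>u. Ho f0 F L x u l t) u = grad (\<lambda>u. L x u t) u + l v* F x t"
proof (rule grad_eqI)
  have "((\<lambda>u. L x u t) has_derivative (\<lambda>h. h \<bullet> grad (\<lambda>u. L x u t) u)) (at u)"
    using cont_diff_GDERIV[OF twice_cont_diff_imp_cont_diff[OF assms]] by (simp add: gderiv_def)
  then have "((\<lambda>u. L x u t + (l \<bullet> f0 x t + (l v* F x t) \<bullet> u)) has_derivative
      (\<lambda>h. h \<bullet> grad (\<lambda>u. L x u t) u + (l v* F x t) \<bullet> h)) (at u)"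
    by (auto intro!: derivative_eq_intros)
  then show "GDERIV (\<lambda>u. Ho f0 F L x u l t) u :> grad (\<lambda>u. L x u t) u + l v* F x t"
    by (simp add: gderiv_def Ho_def inner_add_right dot_lmul_matrix inner_commute[of _ "l v* F x t"])
qed

section \<open>Existence and smoothness of the multiplier\<close>

theorem lemma1:
  fixes f0 :: "real ^ 'n \<Rightarrow> real \<Rightarrow> real ^ 'n"
    and F :: "real ^ 'n \<Rightarrow> real \<Rightarrow> real ^ 'm ^ 'n"
    and S :: "real ^ 'n \<Rightarrow> real \<Rightarrow> real"
    and L :: "real ^ 'n \<Rightarrow> real ^ 'm \<Rightarrow> real \<Rightarrow> real"
    and g :: "real ^ 'n \<Rightarrow> real ^ 'n \<Rightarrow> real \<Rightarrow> real ^ 'm"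
  assumes F_smooth: "twice_cont_diff (\<lambda>(x, t). F x t)"
    and S_smooth: "twice_cont_diff (\<lambda>(x, t). S x t)"
    and f0_smooth: "twice_diff (\<lambda>(x, t). f0 x t)"
    and first_order: "\<And>x t. Sx S x t v* F x t \<noteq> 0"
    and g_unique_min: "\<And>x l t u. is_arg_min (\<lambda>v. Ho f0 F L x v l t) (\<lambda>v. True) u \<longleftrightarrow> u = g x l t"
    and g_smooth: "cont_diff (\<lambda>(x, l, t). g x l t)"
    and L_smooth: "\<And>x t. twice_cont_diff (\<lambda>u. L x u t)"
    and stationary: "\<And>x l t. grad (\<lambda>u. Ho f0 F L x u l t) (g x l t) = 0"
    and legendre_clebsch: "\<And>x l t. pos_def (hessian (\<lambda>u. Ho f0 F L x u l t) (g x l t))"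
  shows "\<exists>h :: real ^ 'n \<Rightarrow> real ^ 'n \<Rightarrow> real \<Rightarrow> real.
    cont_diff (\<lambda>(x, l, t). h x l t) \<and>
    (\<forall>x l t. S x t = 0 \<and> S1 f0 F S x (g x l t) t \<ge> 0 \<longrightarrow>
      h x l t \<ge> 0 \<and>
      {(u, \<mu>). solves_constrained f0 F S L x l t u \<mu>} =
        {(g x (l + h x l t *\<^sub>R Sx S x t) t, h x l t)})"
proof -
  \<comment> \<open>The triple \<open>(x, l, t)\<close> is packed into one parameter, as the
    implicit function lemma expects, and ranges over the whole space rather than over constrained
    arcs.\<close>
  define \<phi> where "\<phi> = (\<lambda>((x, l, t), \<mu>). S1 f0 F S x (g x (l + \<mu> *\<^sub>R Sx S x t) t) t)"
  have grad_S: "cont_diff (grad (\<lambda>(x, t). S x t))" by (rule cont_diff_grad[OF S_smooth])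
  note S_partials = Sx_St_grad[OF twice_cont_diff_imp_cont_diff[OF S_smooth]]
  let ?x = "\<lambda>z::((real^'n) \<times> (real^'n) \<times> real) \<times> real. fst (fst z)"
  let ?l = "\<lambda>z::((real^'n) \<times> (real^'n) \<times> real) \<times> real. fst (snd (fst z))"
  let ?t = "\<lambda>z::((real^'n) \<times> (real^'n) \<times> real) \<times> real. snd (snd (fst z))"
  have x: "cont_diff ?x" and l: "cont_diff ?l" and t: "cont_diff ?t" and \<mu>: "cont_diff (\<lambda>z. snd z)"
    by (intro cont_diff_bounded_linear bounded_linear_intros)+
  note xt = cont_diff_Pair[OF x t]
  have Sx: "cont_diff (\<lambda>z. Sx S (?x z) (?t z))" and St: "cont_diff (\<lambda>z. St S (?x z) (?t z))"
    unfolding S_partials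
    by (intro cont_diff_linear_compose[OF bounded_linear_fst] cont_diff_linear_compose[OF bounded_linear_snd]
        cont_diff_compose[OF grad_S xt])+
  have f0: "cont_diff (\<lambda>z. f0 (?x z) (?t z))"
    using cont_diff_compose[OF twice_diff_imp_cont_diff[OF f0_smooth] xt] by simp
  have F: "cont_diff (\<lambda>z. F (?x z) (?t z))"
    using cont_diff_compose[OF twice_cont_diff_imp_cont_diff[OF F_smooth] xt] by simp
  have l': "cont_diff (\<lambda>z. ?l z + snd z *\<^sub>R Sx S (?x z) (?t z))"
    by (intro cont_diff_add l cont_diff_bilinear[OF bounded_bilinear_scaleR] \<mu> Sx)
  have g: "cont_diff (\<lambda>z. g (?x z) (?l z + snd z *\<^sub>R Sx S (?x z) (?t z)) (?t z))"
    using cont_diff_compose[OF g_smooth cont_diff_Pair[OF x cont_diff_Pair[OF l' t]]] by simp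
  have \<phi>_smooth: "cont_diff \<phi>"
    unfolding \<phi>_def split_beta S1_eq
    by (intro cont_diff_add cont_diff_bilinear[OF bounded_bilinear_inner] Sx f0 St
        cont_diff_bilinear[OF bounded_bilinear_matrix_vector_mult] F g)
  \<comment> \<open>The smoothness of the minimizer along a costate line is that of the joint map
    with \<open>(x, l, t)\<close> frozen.\<close>
  have pathc: "cont_diff (\<lambda>s. g x (l + s *\<^sub>R Sx S x t) t)" for x l t
    using cont_diff_compose[OF g cont_diff_Pair[OF cont_diff_const[of "(x, l, t)"]
          cont_diff_bounded_linear[OF bounded_linear_ident]]] by simp
  have min: "Ho f0 F L x (g x l t) l t \<le> Ho f0 F L x u l t" for x l t u
    using g_unique_min[of x l t "g x l t"] unfolding is_arg_min_def by (meson not_le)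

  have slope: "D < 0" if D: "((\<lambda>s. \<phi> (p, s)) has_real_derivative D) (at s)" for p s D
  proof -
    obtain x l t where p: "p = (x, l, t)" by (metis prod_cases3)
    define \<gamma> where "\<gamma> r = g x (l + r *\<^sub>R Sx S x t) t" for r
    define a where "a = Sx S x t v* F x t"
    obtain \<gamma>' where \<gamma>': "(\<gamma> has_vector_derivative \<gamma>') (at s)"
      using pathc[of x l t] unfolding cont_diff_def \<gamma>_def[abs_def]
      by (meson differentiableI vector_derivative_works)
    obtain G' where G': "(grad (\<lambda>u. L x u t) has_derivative G') (at (\<gamma> s))"
      using cont_diff_grad[OF L_smooth] unfolding cont_diff_def by blast
    have "a \<bullet> \<gamma>' < 0"
    proof (rule stationary_path_slope_neg[OF _ _ G' _ \<gamma>'])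
      show "grad (\<lambda>u. L x u t) (\<gamma> r) + (l v* F x t + r *\<^sub>R a) = 0" for r
        using stationary[of x "l + r *\<^sub>R Sx S x t" t]
        by (simp add: grad_Ho[OF L_smooth] \<gamma>_def a_def vector_matrix_left_distrib scaleR_vector_matrix_assoc)
      show "a \<noteq> 0" using first_order by (simp add: a_def)
      \<comment> \<open>\<open>G'\<close> was taken from the gradient of \<open>L\<close>; it also
        differentiates the gradient of the shifted Hamiltonian, so the Legendre-Clebsch condition
        makes it positive.\<close>
      have "(grad (\<lambda>u. Ho f0 F L x u (l + s *\<^sub>R Sx S x t) t) has_derivative G') (at (\<gamma> s))"
        unfolding grad_Ho[OF L_smooth, abs_def] using G' by (auto intro!: derivative_eq_intros)
      then have "hessian (\<lambda>u. Ho f0 F L x u (l + s *\<^sub>R Sx S x t) t) (\<gamma> s) = matrix G'"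
        unfolding hessian_def by (simp add: frechet_derivative_at[symmetric])
      moreover have "linear G'" using G' has_derivative_linear by blast
      ultimately show "v \<bullet> G' v > 0" if "v \<noteq> 0" for v
        using legendre_clebsch[of x "l + s *\<^sub>R Sx S x t" t] that
        by (simp add: pos_def_def \<gamma>_def matrix_works)
    qed
    moreover have "((\<lambda>s. \<phi> (p, s)) has_real_derivative a \<bullet> \<gamma>') (at s)"
    proof -
      \<comment> \<open>The constraint derivative is affine in the control with coefficient
        \<open>a\<close>, and only the control moves with the multiplier.\<close>
      have "((\<lambda>s. Sx S x t \<bullet> f0 x t + a \<bullet> \<gamma> s + St S x t) has_derivative (\<lambda>r. a \<bullet> (r *\<^sub>R \<gamma>'))) (at s)"
        using \<gamma>' unfolding has_vector_derivative_def by (auto intro!: derivative_eq_intros)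
      then show ?thesis
        by (simp add: has_field_derivative_def p \<phi>_def S1_def \<gamma>_def a_def mult_commute_abs)
    qed
    ultimately show ?thesis using D DERIV_unique by blast
  qed

  have surj: "\<exists>s. \<phi> (p, s) = c" for p c
  proof -
    obtain x l t where p: "p = (x, l, t)" by (metis prod_cases3)
    let ?a = "Sx S x t v* F x t"
    let ?\<gamma> = "\<lambda>s. g x (l + s *\<^sub>R Sx S x t) t"
    have "\<exists>s. ?a \<bullet> ?\<gamma> s = c - Sx S x t \<bullet> f0 x t - St S x t"
    \<comment> \<open>Shifting the costate by \<open>s *\<^sub>R Sx S x t\<close> adds
      \<open>s * (?a \<bullet> u)\<close> and a multiple of
      \<open>Sx S x t \<bullet> f0 x t\<close>; the latter is the same on both sides of the
      comparison and cancels.\<close>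
    proof (rule minimizer_path_level_crossed[where q = "\<lambda>u. Ho f0 F L x u l t"])
      show "Ho f0 F L x (?\<gamma> s) l t + s * (?a \<bullet> ?\<gamma> s) \<le> Ho f0 F L x u l t + s * (?a \<bullet> u)" for s u
        using min[of x "l + s *\<^sub>R Sx S x t" t u]
        by (simp add: Ho_def inner_add_left inner_add_right dot_lmul_matrix algebra_simps)
    qed (simp_all add: first_order cont_diff_imp_continuous[OF pathc])
    then show ?thesis by (auto simp: p \<phi>_def S1_def algebra_simps)
  qed

  have "\<exists>k. cont_diff k \<and> (\<forall>p s. (\<phi> (p, s) < 0 \<longleftrightarrow> k p < s) \<and> (\<phi> (p, s) = 0 \<longleftrightarrow> s = k p))"
    using \<phi>_smooth slope surj by (rule implicit_function_decreasing)
  then obtain k where k: "cont_diff k" "\<And>p s. \<phi> (p, s) < 0 \<longleftrightarrow> k p < s"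
    "\<And>p s. \<phi> (p, s) = 0 \<longleftrightarrow> s = k p"
    by blast
  have sol: "solves_constrained f0 F S L x l t u \<mu> \<longleftrightarrow>
      \<mu> \<ge> 0 \<and> u = g x (l + \<mu> *\<^sub>R Sx S x t) t \<and> \<mu> = k (x, l, t)" for x l t u \<mu>
  proof -
    have "is_arg_min (\<lambda>v. Hc f0 F S L x v l \<mu> t) (\<lambda>v. True) u \<longleftrightarrow> u = g x (l + \<mu> *\<^sub>R Sx S x t) t"
      unfolding g_unique_min[symmetric] by (simp add: is_arg_min_def Hc_eq)
    then show ?thesis using k(3)[of "(x, l, t)" \<mu>] by (auto simp: solves_constrained_def \<phi>_def)
  qed
  show ?thesis
  proof (intro exI[of _ "\<lambda>x l t. k (x, l, t)"] conjI allI impI)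
    show "cont_diff (\<lambda>(x, l, t). k (x, l, t))" using k(1) by simp
    fix x l t assume "S x t = 0 \<and> S1 f0 F S x (g x l t) t \<ge> 0"
    \<comment> \<open>At multiplier 0 the costate is unshifted, so the arc condition says that
      \<open>\<phi>\<close> is nonnegative there, which excludes a negative root.\<close>
    then show "k (x, l, t) \<ge> 0" using k(2)[of "(x, l, t)" 0] by (simp add: \<phi>_def)
    then show "{(u, \<mu>). solves_constrained f0 F S L x l t u \<mu>} =
        {(g x (l + k (x, l, t) *\<^sub>R Sx S x t) t, k (x, l, t))}"
      by (auto simp: sol)
  qed
qed

end
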